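(* Let $P$ be a polymatroid on a finite set $E$ with rank function $f$, and let $P^*$ be its dual polymatroid, with rank function $f^*$. For any $e\in E$ and any $j\in T^*_e=\{\alpha^*_e,\alpha^*_e+1,\ldots,\beta^*_e\}$, where $\alpha^*_e=f^*(E)-f^*(E-e)=0$ and $\beta^*_e=f^*(e)=f(e)+f(E-e)-f(E)$, the slice-projection $(\widehat{P^{*}})^{e}_{j}$ of $P^*$ is connected if and only if the slice-projection $\widehat{P}^{e}_{f(e)-j}$ of $P$ is connected.
   Context: Let $E$ be a finite set (without loss of generality $E=[n]=\{1,\ldots,n\}$). Single elements are identified with singletons: $f(e)=f(\{e\})$, $E-e=E\setminus\{e\}$, $I\cup e=I\cup\{e\}$; and $E-I=E\setminus I$. Rank function. A function $f:2^E\to\mathbb{Z}_{\ge 0}$ is a rank function if (i) $f(\emptyset)=0$; (ii) $f(I)\le f(J)$ for all $I\subseteq J\subseteq E$; (iii) $f(I)+f(J)\ge f(I\cup J)+f(I\cap J)$ for all $I,J\subseteq E$. Polymatroid. The polymatroid $P$ on $E$ with rank function $f$ is $P=\{(a_i)_{i\in E}\in\mathbb{Z}_{\ge 0}^{E} : \sum_{i\in I}a_i\le f(I)\text{ for all } I\subseteq E\}$, and its set of bases is $B_P=\{\mathbf{a}\in P : \sum_{i\in E}a_i=f(E)\}$. The set of bases determines the polymatroid and its rank function, via $f(I)=\max_{\mathbf{a}\in B_P}\sum_{i\in I}a_i$. Connectedness. A polymatroid on $E$ with rank function $f$ is connected if $f(I)+f(E-I)>f(E)$ for all nonempty proper subsets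 $I$ of $E$; otherwise it is disconnected. Slice-projection. For a polymatroid $P$ with rank function $f$ and $e\in E$ put $\alpha_e=f(E)-f(E-e)$, $\beta_e=f(\{e\})$, $T_e=\{\alpha_e,\alpha_e+1,\ldots,\beta_e\}$. For $j\in T_e$, let $B_{\widehat{P}^e_j}\subseteq\mathbb{Z}_{\ge0}^{E-e}$ be the set of vectors obtained by deleting the $e$-th coordinate from those bases $\mathbf{a}\in B_P$ with $a_e=j$. It is known that $B_{\widehat{P}^e_j}$ is the set of bases of a polymatroid on $E-e$; this polymatroid is denoted $\widehat{P}^e_j$ and called a slice-projection of $P$. Dual polymatroid. Given $P$ on $E$ with rank function $f$, define $f^*(I)=f(E-I)+\sum_{i\in I}f(i)-f(E)$ for $I\subseteq E$. It is known that $f^*$ is again a rank function; the polymatroid on $E$ with rank function $f^*$ is the dual polymatroid $P^*$. For $P^*$ and $e\in E$ one has $\alpha^*_e=f^*(E)-f^*(E-e)$, $\beta^*_e=f^*(\{e\})$, $T^*_e=\{\alpha^*_e,\alpha^*_e+1,\ldots,\beta^*_e\}$, and for $j\in T^*_e$ the slice-projection $(\widehat{P^*})^e_j$ is the polymatroid on $E-e$ whose set of bases consists of the vectors obtained by deleting the $e$-th coordinate from those bases $\mathbf{a}\in B_{P^*}$ with $a_e=j$, where $B_{P^*}$ is the set of bases of $P^*$. One has $\beta^*_e=\beta_e-\alpha_e$, so $f(e)-j\in T_e$ for all $j\in T^*_e$. *)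

theory Defs
  imports Complex_Main "HOL-Library.FuncSet"
begin

text \<open>
  Set functions on the subsets of a ground set \<open>E\<close> are integer valued, so that no
  subtraction truncates; their values outside the subsets of \<open>E\<close> are irrelevant.
  Vectors indexed by \<open>E\<close> are extensional functions, so deleting a coordinate
  is a restriction to the smaller index set.
\<close>

definition rank_function :: "'a set \<Rightarrow> ('a set \<Rightarrow> int) \<Rightarrow> bool" where
  "rank_function E f \<longleftrightarrow>
     (\<forall>I\<subseteq>E. 0 \<le> f I) \<and>
     f {} = 0 \<and>
     (\<forall>I J. I \<subseteq> J \<longrightarrow> J \<subseteq> E \<longrightarrow> f I \<le> f J) \<and>
     (\<forall>I J. I \<subseteq> E \<longrightarrow> J \<subseteq> E \<longrightarrow> f I + f J \<ge> f (I \<union> J) + f (I \<inter> J))"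

definition polymatroid :: "'a set \<Rightarrow> ('a set \<Rightarrow> int) \<Rightarrow> ('a \<Rightarrow> int) set" where
  "polymatroid E f = {a \<in> E \<rightarrow>\<^sub>E {0..}. \<forall>I\<subseteq>E. (\<Sum>i\<in>I. a i) \<le> f I}"

definition bases :: "'a set \<Rightarrow> ('a set \<Rightarrow> int) \<Rightarrow> ('a \<Rightarrow> int) set" where
  "bases E f = {a \<in> polymatroid E f. (\<Sum>i\<in>E. a i) = f E}"

text \<open>
  The rank function of the polymatroid whose set of bases is \<open>B\<close>. It is meaningful
  only if \<open>B\<close> is such a set; see \<open>rank_of_bases_bases\<close> below.
\<close>
definition rank_of_bases :: "('a \<Rightarrow> int) set \<Rightarrow> 'a set \<Rightarrow> int" where
  "rank_of_bases B I = Max ((\<lambda>a. \<Sum>i\<in>I. a i) ` B)"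

definition connected_rank :: "'a set \<Rightarrow> ('a set \<Rightarrow> int) \<Rightarrow> bool" where
  "connected_rank E f \<longleftrightarrow> (\<forall>I. I \<noteq> {} \<longrightarrow> I \<subset> E \<longrightarrow> f I + f (E - I) > f E)"

definition alpha :: "'a set \<Rightarrow> ('a set \<Rightarrow> int) \<Rightarrow> 'a \<Rightarrow> int" where
  "alpha E f e = f E - f (E - {e})"

definition beta :: "('a set \<Rightarrow> int) \<Rightarrow> 'a \<Rightarrow> int" where
  "beta f e = f {e}"

definition slice_bases :: "'a set \<Rightarrow> ('a set \<Rightarrow> int) \<Rightarrow> 'a \<Rightarrow> int \<Rightarrow> ('a \<Rightarrow> int) set" where
  "slice_bases E f e j = (\<lambda>a. restrict a (E - {e})) ` {a \<in> bases E f. a e = j}"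

text \<open>
  The slice-projection, given by its rank function on \<open>E - {e}\<close>. That this is a rank
  function, and that its bases are exactly \<open>slice_bases E f e j\<close>, is proved below for
  \<open>alpha E f e \<le> j \<le> beta f e\<close>.
\<close>
definition slice_rank :: "'a set \<Rightarrow> ('a set \<Rightarrow> int) \<Rightarrow> 'a \<Rightarrow> int \<Rightarrow> 'a set \<Rightarrow> int" where
  "slice_rank E f e j = rank_of_bases (slice_bases E f e j)"

definition dual_rank :: "'a set \<Rightarrow> ('a set \<Rightarrow> int) \<Rightarrow> 'a set \<Rightarrow> int" where
  "dual_rank E f I = f (E - I) + (\<Sum>i\<in>I. f {i}) - f E"


subsection \<open>Well-definedness\<close>

lemma rank_functionD:
  assumes "rank_function E f"
  shows "f {} = 0"
    and "\<And>I. I \<subseteq> E \<Longrightarrow> 0 \<le> f I"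
    and "\<And>I J. I \<subseteq> J \<Longrightarrow> J \<subseteq> E \<Longrightarrow> f I \<le> f J"
    and "\<And>I J. I \<subseteq> E \<Longrightarrow> J \<subseteq> E \<Longrightarrow> f (I \<union> J) + f (I \<inter> J) \<le> f I + f J"
  using assms unfolding rank_function_def by blast+

lemma rank_function_subset:
  assumes "rank_function E f" "A \<subseteq> E"
  shows "rank_function A f"
  using assms unfolding rank_function_def by (meson subset_trans)

lemma finite_bases:
  assumes "finite E"
  shows "finite (bases E f)"
proof (rule finite_subset)
  show "bases E f \<subseteq> (\<Pi>\<^sub>E i\<in>E. {0..f {i}})"
  proof
    fix a assume "a \<in> bases E f"
    then have a: "a \<in> E \<rightarrow>\<^sub>E {0..}" and le: "\<forall>I\<subseteq>E. (\<Sum>i\<in>I. a i) \<le> f I"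
      by (auto simp: bases_def polymatroid_def)
    have "a i \<le> f {i}" if "i \<in> E" for i
      using le[rule_format, of "{i}"] that by simp
    with a show "a \<in> (\<Pi>\<^sub>E i\<in>E. {0..f {i}})" by (auto simp: PiE_iff)
  qed
  show "finite (\<Pi>\<^sub>E i\<in>E. {0..f {i}})" using assms by (intro finite_PiE) auto
qed

lemma bases_extend_one:
  assumes f: "rank_function (insert x A) f" and fin: "finite A" and x: "x \<notin> A"
    and a: "a \<in> bases A f"
  shows "a(x := f (insert x A) - f A) \<in> bases (insert x A) f"
proof -
  let ?b = "a(x := f (insert x A) - f A)"
  have aE: "a \<in> A \<rightarrow>\<^sub>E {0..}" and le: "\<And>I. I \<subseteq> A \<Longrightarrow> (\<Sum>i\<in>I. a i) \<le> f I"
    and sum: "(\<Sum>i\<in>A. a i) = f A"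
    using a by (auto simp: bases_def polymatroid_def)
  have "f A \<le> f (insert x A)" using rank_functionD(3)[OF f] by blast
  then have bE: "?b \<in> insert x A \<rightarrow>\<^sub>E {0..}"
    using aE by (auto simp: PiE_iff extensional_def)
  have eq: "(\<Sum>i\<in>I. ?b i) = (\<Sum>i\<in>I. a i)" if "x \<notin> I" for I
    using that by (intro sum.cong) auto
  have "(\<Sum>i\<in>K. ?b i) \<le> f K" if K: "K \<subseteq> insert x A" for K
  proof (cases "x \<in> K")
    case False
    then show ?thesis using K le[of K] eq[OF False] by auto
  next
    case True
    have finK: "finite K" using K fin by (meson finite_insert finite_subset)
    have "(\<Sum>i\<in>K. ?b i) = f (insert x A) - f A + (\<Sum>i\<in>K - {x}. ?b i)"
      using True finK by (subst sum.remove[of _ x]) auto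
    also have "(\<Sum>i\<in>K - {x}. ?b i) = (\<Sum>i\<in>K - {x}. a i)" by (rule eq) simp
    also have "\<dots> \<le> f (K - {x})" using K by (intro le) auto
    finally have 1: "(\<Sum>i\<in>K. ?b i) \<le> f (insert x A) - f A + f (K - {x})" by simp
    have "f (K \<union> A) + f (K \<inter> A) \<le> f K + f A"
      using K by (intro rank_functionD(4)[OF f]) auto
    moreover have "K \<union> A = insert x A" "K \<inter> A = K - {x}" using K True x by auto
    ultimately show ?thesis using 1 by simp
  qed
  moreover have "(\<Sum>i\<in>insert x A. ?b i) = f (insert x A)"
    using fin x eq[OF x] sum by simp
  ultimately show ?thesis using bE by (auto simp: bases_def polymatroid_def)
qed

lemma bases_extend:
  assumes "finite D" "finite A" "rank_function (A \<union> D) f" "a \<in> bases A f"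
  shows "\<exists>b\<in>bases (A \<union> D) f. \<forall>i\<in>A. b i = a i"
  using assms
proof (induction D rule: finite_induct)
  case empty
  then show ?case by auto
next
  case (insert x D)
  have "rank_function (A \<union> D) f"
    using insert.prems(2) by (rule rank_function_subset) auto
  then obtain b where b: "b \<in> bases (A \<union> D) f" "\<forall>i\<in>A. b i = a i"
    using insert by blast
  show ?case
  proof (cases "x \<in> A \<union> D")
    case True
    then have "A \<union> insert x D = A \<union> D" by auto
    with b show ?thesis by auto
  next
    case False
    have eq: "A \<union> insert x D = insert x (A \<union> D)" by auto
    let ?b = "b(x := f (insert x (A \<union> D)) - f (A \<union> D))"
    have "?b \<in> bases (insert x (A \<union> D)) f"
      using insert.prems insert.hyps b(1) False
      by (intro bases_extend_one) auto
    moreover have "\<forall>i\<in>A. ?b i = a i" using b(2) False by auto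
    ultimately show ?thesis unfolding eq by blast
  qed
qed

lemma ex_basis_attaining:
  assumes "rank_function E f" "finite E" "I \<subseteq> E"
  shows "\<exists>a\<in>bases E f. (\<Sum>i\<in>I. a i) = f I"
proof -
  have "(\<lambda>_. undefined) \<in> bases {} f"
    using rank_functionD(1)[OF assms(1)] by (auto simp: bases_def polymatroid_def)
  moreover have "rank_function ({} \<union> I) f" "finite I"
    using assms by (auto intro: rank_function_subset finite_subset)
  ultimately obtain a where a: "a \<in> bases I f"
    using bases_extend[of I "{}" f] by auto
  have "I \<union> (E - I) = E" using assms(3) by auto
  then obtain b where "b \<in> bases E f" "\<forall>i\<in>I. b i = a i"
    using bases_extend[of "E - I" I f a] a assms \<open>finite I\<close> by auto
  moreover have "(\<Sum>i\<in>I. a i) = f I" using a by (simp add: bases_def)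
  ultimately show ?thesis by (metis (mono_tags, lifting) sum.cong)
qed

lemma rank_of_bases_bases:
  assumes "rank_function E f" "finite E" "I \<subseteq> E"
  shows "rank_of_bases (bases E f) I = f I"
  unfolding rank_of_bases_def
proof (rule Max_eqI)
  show "finite ((\<lambda>a. \<Sum>i\<in>I. a i) ` bases E f)" using finite_bases assms(2) by blast
  show "y \<le> f I" if "y \<in> (\<lambda>a. \<Sum>i\<in>I. a i) ` bases E f" for y
    using that assms(3) by (auto simp: bases_def polymatroid_def)
  show "f I \<in> (\<lambda>a. \<Sum>i\<in>I. a i) ` bases E f"
    using ex_basis_attaining[OF assms] by (metis imageI)
qed

lemma bases_cong:
  assumes "\<And>I. I \<subseteq> E \<Longrightarrow> f I = g I"
  shows "bases E f = bases E g"
  using assms by (auto simp: bases_def polymatroid_def)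

lemma rank_function_cong:
  assumes "\<And>I. I \<subseteq> E \<Longrightarrow> f I = g I"
  shows "rank_function E f = rank_function E g"
proof -
  have "rank_function E h'" if h: "rank_function E h" and eq: "\<And>I. I \<subseteq> E \<Longrightarrow> h I = h' I"
    for h h' :: "'a set \<Rightarrow> int"
    unfolding rank_function_def
  proof (intro conjI allI impI)
    show "h' {} = 0" using rank_functionD(1)[OF h] eq[of "{}"] by simp
    show "0 \<le> h' I" if "I \<subseteq> E" for I using rank_functionD(2)[OF h that] eq[OF that] by simp
    show "h' I \<le> h' J" if "I \<subseteq> J" "J \<subseteq> E" for I J
      using rank_functionD(3)[OF h that] eq[of I] eq[of J] that by auto
    show "h' (I \<union> J) + h' (I \<inter> J) \<le> h' I + h' J" if "I \<subseteq> E" "J \<subseteq> E" for I J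
    proof -
      have "I \<union> J \<subseteq> E" "I \<inter> J \<subseteq> E" using that by auto
      then show ?thesis
        using rank_functionD(4)[OF h that] eq[of I] eq[of J] eq[of "I \<union> J"] eq[of "I \<inter> J"] that
        by simp
    qed
  qed
  from this[of f g] this[of g f] assms show ?thesis by metis
qed

lemma slice_aux:
  fixes f :: "'a set \<Rightarrow> int"
  defines "g \<equiv> \<lambda>e j I. min (f I) (f (insert e I) - j)"
  assumes f: "rank_function E f" and fin: "finite E" and e: "e \<in> E"
    and j: "j \<in> {alpha E f e..beta f e}"
  shows "rank_function (E - {e}) (g e j)"
    and "bases (E - {e}) (g e j) = slice_bases E f e j"
proof -
  let ?E = "E - {e}" and ?g = "g e j"
  note mono = rank_functionD(3)[OF f] and sub = rank_functionD(4)[OF f]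
  have ins: "insert e ?E = E" using e by auto
  have je: "f E - f ?E \<le> j" "j \<le> f {e}" using j by (auto simp: alpha_def beta_def)
  have "0 \<le> f E - f ?E" using mono[of ?E E] by auto
  then have j0: "0 \<le> j" using je by simp
  have g0: "?g {} = 0" using je rank_functionD(1)[OF f] by (simp add: g_def)
  have gmono: "?g I \<le> ?g J" if "I \<subseteq> J" "J \<subseteq> ?E" for I J
  proof -
    have "f I \<le> f J" "f (insert e I) \<le> f (insert e J)"
      using that e by (auto intro!: mono)
    then show ?thesis by (auto simp: g_def min_def)
  qed
  show "rank_function ?E ?g"
    unfolding rank_function_def
  proof (intro conjI allI impI)
    show "0 \<le> ?g I" if "I \<subseteq> ?E" for I using gmono[of "{}" I] g0 that by simp
    show "?g {} = 0" by (rule g0)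
    show "?g I \<le> ?g J" if "I \<subseteq> J" "J \<subseteq> ?E" for I J using gmono that .
    show "?g (I \<union> J) + ?g (I \<inter> J) \<le> ?g I + ?g J" if "I \<subseteq> ?E" "J \<subseteq> ?E" for I J
    proof -
      have IJ: "I \<subseteq> E" "J \<subseteq> E" "insert e I \<subseteq> E" "insert e J \<subseteq> E" "e \<notin> I" "e \<notin> J"
        using that e by auto
      have "f (I \<union> J) + f (I \<inter> J) \<le> f I + f J"
        using sub[OF IJ(1,2)] .
      moreover have "f (insert e (I \<union> J)) + f (I \<inter> J) \<le> f (insert e I) + f J"
        using sub[OF IJ(3,2)] IJ(6) by simp
      moreover have "f (insert e (I \<union> J)) + f (I \<inter> J) \<le> f I + f (insert e J)"
        using sub[OF IJ(1,4)] IJ(5) by simp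
      moreover have "f (insert e (I \<union> J)) + f (insert e (I \<inter> J)) \<le> f (insert e I) + f (insert e J)"
        using sub[OF IJ(3,4)] by (simp add: insert_commute)
      ultimately show ?thesis by (auto simp: g_def min_def)
    qed
  qed
  have gE: "?g ?E = f E - j" using je ins by (simp add: g_def)
  show "bases ?E ?g = slice_bases E f e j"
  proof (intro set_eqI iffI)
    fix b assume b: "b \<in> bases ?E ?g"
    then have bE: "b \<in> ?E \<rightarrow>\<^sub>E {0..}" and le: "\<And>I. I \<subseteq> ?E \<Longrightarrow> (\<Sum>i\<in>I. b i) \<le> ?g I"
      and sum: "(\<Sum>i\<in>?E. b i) = ?g ?E"
      by (auto simp: bases_def polymatroid_def)
    let ?a = "b(e := j)"
    have eq: "(\<Sum>i\<in>I. ?a i) = (\<Sum>i\<in>I. b i)" if "e \<notin> I" for I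
      using that by (intro sum.cong) auto
    have split: "(\<Sum>i\<in>K. ?a i) = j + (\<Sum>i\<in>K - {e}. b i)" if "K \<subseteq> E" "e \<in> K" for K
      using eq[of "K - {e}"] finite_subset[OF that(1) fin] that(2)
      by (simp add: sum.remove)
    have "(\<Sum>i\<in>K. ?a i) \<le> f K" if K: "K \<subseteq> E" for K
    proof (cases "e \<in> K")
      case True
      then have "insert e (K - {e}) = K" by auto
      moreover have "(\<Sum>i\<in>K - {e}. b i) \<le> ?g (K - {e})" using K by (intro le) auto
      ultimately show ?thesis using split[OF K True] by (simp add: g_def)
    next
      case False
      then have "(\<Sum>i\<in>K. b i) \<le> ?g K" using K by (intro le) auto
      then show ?thesis using eq[OF False] by (simp add: g_def)
    qed
    moreover have "(\<Sum>i\<in>E. ?a i) = f E" using split[of E] e sum gE by simp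
    moreover have "?a \<in> E \<rightarrow>\<^sub>E {0..}" using bE j0 e by (auto simp: PiE_iff extensional_def)
    ultimately have "?a \<in> bases E f" by (auto simp: bases_def polymatroid_def)
    moreover have "restrict ?a ?E = b" using bE by (auto simp: PiE_iff extensional_def fun_eq_iff)
    ultimately show "b \<in> slice_bases E f e j"
      unfolding slice_bases_def by (intro image_eqI[of _ _ ?a]) auto
  next
    fix b assume "b \<in> slice_bases E f e j"
    then obtain a where a: "a \<in> bases E f" "a e = j" and b: "b = restrict a ?E"
      by (auto simp: slice_bases_def)
    then have aE: "a \<in> E \<rightarrow>\<^sub>E {0..}" and le: "\<And>I. I \<subseteq> E \<Longrightarrow> (\<Sum>i\<in>I. a i) \<le> f I"
      and sum: "(\<Sum>i\<in>E. a i) = f E"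
      by (auto simp: bases_def polymatroid_def)
    have eq: "(\<Sum>i\<in>I. b i) = (\<Sum>i\<in>I. a i)" if "I \<subseteq> ?E" for I
      using that unfolding b by (intro sum.cong) auto
    have "(\<Sum>i\<in>I. b i) \<le> ?g I" if I: "I \<subseteq> ?E" for I
    proof -
      have "finite I" "e \<notin> I" using I fin by (auto intro: finite_subset)
      then have "(\<Sum>i\<in>insert e I. a i) = j + (\<Sum>i\<in>I. a i)" using a(2) by simp
      moreover have "(\<Sum>i\<in>insert e I. a i) \<le> f (insert e I)" "(\<Sum>i\<in>I. a i) \<le> f I"
        using I e by (auto intro!: le)
      ultimately show ?thesis using eq[OF I] by (simp add: g_def)
    qed
    moreover have "(\<Sum>i\<in>?E. b i) = ?g ?E"
      using eq[of ?E] gE sum a(2) fin e by (simp add: sum.remove)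
    moreover have "b \<in> ?E \<rightarrow>\<^sub>E {0..}" using aE unfolding b by auto
    ultimately show "b \<in> bases ?E ?g" by (auto simp: bases_def polymatroid_def)
  qed
qed

lemma slice_rank_eq_min:
  assumes "rank_function E f" "finite E" "e \<in> E" "j \<in> {alpha E f e..beta f e}" "I \<subseteq> E - {e}"
  shows "slice_rank E f e j I = min (f I) (f (insert e I) - j)"
  unfolding slice_rank_def slice_aux(2)[OF assms(1-4), symmetric]
  using slice_aux(1)[OF assms(1-4)] assms(2,5) by (intro rank_of_bases_bases) auto

theorem slice_projection_well_defined:
  assumes "rank_function E f" "finite E" "e \<in> E" "j \<in> {alpha E f e..beta f e}"
  shows "rank_function (E - {e}) (slice_rank E f e j)"
    and "bases (E - {e}) (slice_rank E f e j) = slice_bases E f e j"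
proof -
  let ?g = "\<lambda>I. min (f I) (f (insert e I) - j)"
  have eq: "slice_rank E f e j I = ?g I" if "I \<subseteq> E - {e}" for I
    using slice_rank_eq_min[OF assms that] .
  show "rank_function (E - {e}) (slice_rank E f e j)"
    using slice_aux(1)[OF assms] rank_function_cong[of "E - {e}" "slice_rank E f e j" ?g] eq
    by simp
  show "bases (E - {e}) (slice_rank E f e j) = slice_bases E f e j"
    using slice_aux(2)[OF assms] bases_cong[of "E - {e}" "slice_rank E f e j" ?g] eq
    by simp
qed

lemma dual_rank_mono:
  assumes f: "rank_function E f" and fin: "finite E" and IJ: "I \<subseteq> J" "J \<subseteq> E"
  shows "dual_rank E f I \<le> dual_rank E f J"
proof -
  have "f (A \<union> D) \<le> f A + (\<Sum>i\<in>D. f {i})" if "finite D" "A \<subseteq> E" "D \<subseteq> E" for A D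
    using that
  proof (induction D rule: finite_induct)
    case empty
    then show ?case by simp
  next
    case (insert x D)
    have "f ((A \<union> D) \<union> {x}) + f ((A \<union> D) \<inter> {x}) \<le> f (A \<union> D) + f {x}"
      using insert.prems by (intro rank_functionD(4)[OF f]) auto
    moreover have "0 \<le> f ((A \<union> D) \<inter> {x})"
      using insert.prems by (intro rank_functionD(2)[OF f]) auto
    moreover have "A \<union> insert x D = (A \<union> D) \<union> {x}" by auto
    moreover have "f (A \<union> D) \<le> f A + (\<Sum>i\<in>D. f {i})" using insert by auto
    ultimately show ?case using insert.hyps by simp
  qed
  from this[of "J - I" "E - J"]
  have "f ((E - J) \<union> (J - I)) \<le> f (E - J) + (\<Sum>i\<in>J - I. f {i})"
    using IJ fin by (meson Diff_subset finite_Diff finite_subset order_trans)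
  moreover have "(E - J) \<union> (J - I) = E - I" using IJ by auto
  moreover have "(\<Sum>i\<in>J. f {i}) = (\<Sum>i\<in>J - I. f {i}) + (\<Sum>i\<in>I. f {i})"
    using IJ fin by (intro sum.subset_diff) (auto intro: finite_subset)
  ultimately show ?thesis by (simp add: dual_rank_def)
qed

theorem rank_function_dual_rank:
  assumes f: "rank_function E f" and fin: "finite E"
  shows "rank_function E (dual_rank E f)"
  unfolding rank_function_def
proof (intro conjI allI impI)
  show 0: "dual_rank E f {} = 0" by (simp add: dual_rank_def)
  show "0 \<le> dual_rank E f I" if "I \<subseteq> E" for I
    using dual_rank_mono[OF f fin, of "{}" I] that 0 by simp
  show "dual_rank E f I \<le> dual_rank E f J" if "I \<subseteq> J" "J \<subseteq> E" for I J
    using dual_rank_mono[OF f fin that] .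
  show "dual_rank E f (I \<union> J) + dual_rank E f (I \<inter> J) \<le> dual_rank E f I + dual_rank E f J"
    if "I \<subseteq> E" "J \<subseteq> E" for I J
  proof -
    have "f ((E - I) \<union> (E - J)) + f ((E - I) \<inter> (E - J)) \<le> f (E - I) + f (E - J)"
      by (intro rank_functionD(4)[OF f]) auto
    moreover have "(E - I) \<union> (E - J) = E - (I \<inter> J)" "(E - I) \<inter> (E - J) = E - (I \<union> J)" by auto
    moreover have "(\<Sum>i\<in>I \<union> J. f {i}) + (\<Sum>i\<in>I \<inter> J. f {i}) = (\<Sum>i\<in>I. f {i}) + (\<Sum>i\<in>J. f {i})"
      using that fin by (intro sum.union_inter) (auto intro: finite_subset)
    ultimately show ?thesis by (simp add: dual_rank_def)
  qed
qed

end

theory Submission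
  imports Defs
begin

text \<open>
  Connectedness only sees the gap \<open>h I + h (E - I) - h E\<close>. If \<open>h {} = 0\<close>, this gap does not change when
  \<open>h\<close> is replaced by \<open>I \<mapsto> h (E - I) + w(I) - h E\<close> for an arbitrary modular weight \<open>w\<close>:
  the complement swaps the first two terms, and the weights of \<open>I\<close> and \<open>E - I\<close> add up to that of \<open>E\<close>
  (\<open>connected_rank_weighted_complement\<close>). The usual dual takes \<open>w(I)\<close> to be the sum of the
  ranks of the singletons.

  Slicing and dualizing commute up to the choice of this weight. The slice at \<open>j\<close> has rank function
  \<open>I \<mapsto> min (f I) (f (I \<union> e) - j)\<close>, and since \<open>E - I\<close> contains \<open>e\<close> exactly when
  \<open>I\<close> does not, the two arguments of the minimum change places when \<open>f\<close> is dualized, with the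
  height \<open>j\<close> becoming \<open>f(e) - j\<close>. So the slice of the dual is the weighted complement of
  the slice of \<open>P\<close> (\<open>slice_rank_dual_rank\<close>). The weight is still made from the singleton ranks of
  \<open>P\<close> rather than those of the slice, so the slice of the dual need not be the dual of the
  slice; connectedness does not notice the difference.
\<close>

lemma connected_rank_weighted_complement:
  fixes w :: "'a \<Rightarrow> int"
  assumes "finite E" and "h {} = 0"
    and g: "\<And>I. I \<subseteq> E \<Longrightarrow> g I = h (E - I) + (\<Sum>i\<in>I. w i) - h E"
  shows "connected_rank E g \<longleftrightarrow> connected_rank E h"
proof -
  have "g I + g (E - I) - g E = h I + h (E - I) - h E" if "I \<subseteq> E" for I
  proof -
    have "E - (E - I) = I" using that by auto
    moreover have "(\<Sum>i\<in>E. w i) = (\<Sum>i\<in>E - I. w i) + (\<Sum>i\<in>I. w i)"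
      using assms(1) that by (rule sum.subset_diff[rotated])
    ultimately show ?thesis using g[OF that] g[of "E - I"] g[of E] \<open>h {} = 0\<close> by simp
  qed
  then have "g I + g (E - I) > g E \<longleftrightarrow> h I + h (E - I) > h E" if "I \<subset> E" for I
    using that by (smt (verit) psubset_imp_subset)
  then show ?thesis unfolding connected_rank_def by blast
qed

text \<open>
  If \<open>f\<close> is the rank function of \<open>P\<close>, then some basis of \<open>P\<close> has the \<open>e\<close>-th coordinate \<open>f(e)\<close>, and the map
  \<open>a \<mapsto> (\<lambda>i. f(i) - a i)\<close> from the bases of \<open>P\<close> to those of the dual sends it to
  one with the \<open>e\<close>-th coordinate \<open>0\<close>.
\<close>
lemma alpha_dual_rank:
  assumes "finite E" and "f {} = 0" and "e \<in> E"
  shows "alpha E (dual_rank E f) e = 0"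
proof -
  have "E - (E - {e}) = {e}" using assms(3) by auto
  then show ?thesis
    using assms by (simp add: alpha_def dual_rank_def sum.remove[of E e])
qed

lemma beta_dual_rank: "beta (dual_rank E f) e = f {e} + f (E - {e}) - f E"
  by (simp add: beta_def dual_rank_def)

lemma dual_height_in_range:
  assumes "finite E" and "rank_function E f" and "e \<in> E"
    and "j \<in> {alpha E (dual_rank E f) e..beta (dual_rank E f) e}"
  shows "f {e} - j \<in> {alpha E f e..beta f e}"
proof -
  have "alpha E (dual_rank E f) e = 0"
    using assms(1) rank_functionD(1)[OF assms(2)] assms(3) by (rule alpha_dual_rank)
  with assms(4) have "0 \<le> j" "j \<le> f {e} + f (E - {e}) - f E"
    by (simp_all add: beta_dual_rank)
  then show ?thesis by (simp add: alpha_def beta_def)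
qed

lemma slice_rank_dual_rank:
  assumes fin: "finite E" and f: "rank_function E f" and e: "e \<in> E"
    and j: "j \<in> {alpha E (dual_rank E f) e..beta (dual_rank E f) e}"
    and I: "I \<subseteq> E - {e}"
  shows "slice_rank E (dual_rank E f) e j I =
      slice_rank E f e (f {e} - j) ((E - {e}) - I) + (\<Sum>i\<in>I. f {i})
        - slice_rank E f e (f {e} - j) (E - {e})"
proof -
  let ?J = "(E - {e}) - I"
  have j': "f {e} - j \<in> {alpha E f e..beta f e}"
    using fin f e j by (rule dual_height_in_range)
  have sets: "E - I = insert e ?J" "E - insert e I = ?J" "insert e (E - {e}) = E"
    using I e by auto
  have "finite I" "e \<notin> I" using I fin by (auto intro: finite_subset)
  then have dual_values:
    "dual_rank E f I = f (insert e ?J) + (\<Sum>i\<in>I. f {i}) - f E"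
    "dual_rank E f (insert e I) = f ?J + f {e} + (\<Sum>i\<in>I. f {i}) - f E"
    unfolding dual_rank_def sets by simp_all
  have "slice_rank E (dual_rank E f) e j I
      = min (dual_rank E f I) (dual_rank E f (insert e I) - j)"
    by (rule slice_rank_eq_min[OF rank_function_dual_rank[OF f fin] fin e j I])
  moreover have "slice_rank E f e (f {e} - j) ?J = min (f ?J) (f (insert e ?J) - (f {e} - j))"
    by (rule slice_rank_eq_min[OF f fin e j']) blast
  \<comment> \<open>The lower bound on the height makes the second argument of the minimum the smaller one.\<close>
  moreover have "slice_rank E f e (f {e} - j) (E - {e}) = f E - (f {e} - j)"
    using slice_rank_eq_min[OF f fin e j' subset_refl] j' sets(3) by (simp add: alpha_def)
  ultimately show ?thesis using dual_values by simp
qed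

theorem theorem1p10:
  fixes E :: "'a set" and f :: "'a set \<Rightarrow> int" and e :: 'a
  assumes "finite E" and "rank_function E f" and "e \<in> E"
  shows "alpha E (dual_rank E f) e = 0
    \<and> beta (dual_rank E f) e = f {e} + f (E - {e}) - f E
    \<and> (\<forall>j \<in> {alpha E (dual_rank E f) e..beta (dual_rank E f) e}.
         connected_rank (E - {e}) (slice_rank E (dual_rank E f) e j)
         \<longleftrightarrow> connected_rank (E - {e}) (slice_rank E f e (f {e} - j)))"
proof (intro conjI ballI)
  show "alpha E (dual_rank E f) e = 0"
    using assms rank_functionD(1) by (intro alpha_dual_rank) auto
  show "beta (dual_rank E f) e = f {e} + f (E - {e}) - f E" by (rule beta_dual_rank)
  fix j assume j: "j \<in> {alpha E (dual_rank E f) e..beta (dual_rank E f) e}"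
  then have "f {e} - j \<in> {alpha E f e..beta f e}"
    by (rule dual_height_in_range[OF assms])
  then have "slice_rank E f e (f {e} - j) {} = 0"
    using assms by (intro rank_functionD(1)[OF slice_projection_well_defined(1)])
  then show "connected_rank (E - {e}) (slice_rank E (dual_rank E f) e j)
      \<longleftrightarrow> connected_rank (E - {e}) (slice_rank E f e (f {e} - j))"
    using assms slice_rank_dual_rank[OF assms j]
    by (intro connected_rank_weighted_complement[where w = "\<lambda>i. f {i}"]) auto
qed

end
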